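(* For all positive integers $n,k$ with $n\ge 2k$, the Schrijver graph $S(n,k)$ contains $K_{n-2k+2}$ as an odd-minor; consequently the Kneser graph $K(n,k)$ also contains $K_{n-2k+2}$ as an odd-minor.
   Context: For positive integers $n\ge 2k$, the Kneser graph $K(n,k)$ has as vertices the $k$-element subsets of $[n]=\{1,\dots,n\}$, two being adjacent iff they are disjoint. A subset of $[n]$ is cyclically stable if it contains no two elements that are consecutive in the cyclic order $1,2,\dots,n,1$ (so in particular not both $1$ and $n$). The Schrijver graph $S(n,k)$ is the subgraph of $K(n,k)$ induced by the cyclically stable $k$-subsets of $[n]$. A graph $G$ contains $H$ as an odd-minor if a graph isomorphic to $H$ can be obtained from some subgraph $G'\subseteq G$ by choosing an edge-cut of $G'$ (the set of edges between $S$ and $V(G')\setminus S$ for some $S\subseteq V(G')$) and contracting all edges of this cut simultaneously. *)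

theory Defs
  imports Main
begin

type_synonym 'a graph = "'a set \<times> 'a set set"

abbreviation verts :: "'a graph \<Rightarrow> 'a set" where "verts \<equiv> fst"
abbreviation edges :: "'a graph \<Rightarrow> 'a set set" where "edges \<equiv> snd"

definition simple_graph :: "'a graph \<Rightarrow> bool" where
  "simple_graph G \<longleftrightarrow> (\<forall>e\<in>edges G. e \<subseteq> verts G \<and> card e = 2)"

definition subgraph :: "'a graph \<Rightarrow> 'a graph \<Rightarrow> bool" where
  "subgraph G' G \<longleftrightarrow> simple_graph G' \<and> verts G' \<subseteq> verts G \<and> edges G' \<subseteq> edges G"

definition induced_subgraph :: "'a graph \<Rightarrow> 'a set \<Rightarrow> 'a graph" where
  "induced_subgraph G W = (W, {e \<in> edges G. e \<subseteq> W})"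

definition graph_iso :: "'a graph \<Rightarrow> 'b graph \<Rightarrow> bool" where
  "graph_iso G H \<longleftrightarrow> (\<exists>f. bij_betw f (verts G) (verts H) \<and>
     (\<forall>u\<in>verts G. \<forall>v\<in>verts G. {u, v} \<in> edges G \<longleftrightarrow> {f u, f v} \<in> edges H))"

definition complete_graph :: "nat \<Rightarrow> nat graph" where
  "complete_graph m = ({1..m}, {e. e \<subseteq> {1..m} \<and> card e = 2})"

definition edge_cut :: "'a graph \<Rightarrow> 'a set \<Rightarrow> 'a set set" where
  "edge_cut G S = {{u, v} | u v. u \<in> S \<and> v \<in> verts G - S \<and> {u, v} \<in> edges G}"

text \<open>The relation of lying in the same connected component of the spanning subgraph with
  edge set \<open>F\<close>.\<close>

definition connected_by :: "'a graph \<Rightarrow> 'a set set \<Rightarrow> ('a \<times> 'a) set" where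
  "connected_by G F = {(u, v). u \<in> verts G \<and> v \<in> verts G \<and> (u, v) \<in> {(x, y). {x, y} \<in> F}\<^sup>*}"

text \<open>Simultaneous contraction of all edges in \<open>F\<close>: the vertices are the components of the
  spanning subgraph with edge set \<open>F\<close>. Loops are dropped and parallel edges identified. For odd
  minors this convention is immaterial: a remaining edge that would become a loop, or all but one
  of several that would become parallel, can be removed from the subgraph beforehand without
  changing the cut.\<close>

definition contract :: "'a graph \<Rightarrow> 'a set set \<Rightarrow> 'a set graph" where
  "contract G F =
     (let C = verts G // connected_by G F
      in (C, {{X, Y} | X Y. X \<in> C \<and> Y \<in> C \<and> X \<noteq> Y \<and>
                (\<exists>x\<in>X. \<exists>y\<in>Y. {x, y} \<in> edges G - F)}))"

definition has_odd_minor :: "'a graph \<Rightarrow> 'b graph \<Rightarrow> bool" where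
  "has_odd_minor G H \<longleftrightarrow>
     (\<exists>G' S. subgraph G' G \<and> S \<subseteq> verts G' \<and> graph_iso (contract G' (edge_cut G' S)) H)"

definition kneser_graph :: "nat \<Rightarrow> nat \<Rightarrow> nat set graph" where
  "kneser_graph n k =
     (let V = {A. A \<subseteq> {1..n} \<and> card A = k}
      in (V, {{A, B} | A B. A \<in> V \<and> B \<in> V \<and> A \<inter> B = {}}))"

definition cyclic_succ :: "nat \<Rightarrow> nat \<Rightarrow> nat" where
  "cyclic_succ n i = (if i = n then 1 else Suc i)"

definition cyclically_stable :: "nat \<Rightarrow> nat set \<Rightarrow> bool" where
  "cyclically_stable n A \<longleftrightarrow>
     A \<subseteq> {1..n} \<and> \<not> (\<exists>i\<in>A. \<exists>j\<in>A. i \<noteq> j \<and> j = cyclic_succ n i)"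

definition schrijver_graph :: "nat \<Rightarrow> nat \<Rightarrow> nat set graph" where
  "schrijver_graph n k =
     induced_subgraph (kneser_graph n k) {A \<in> verts (kneser_graph n k). cyclically_stable n A}"

lemma simple_graph_complete: "simple_graph (complete_graph m)"
  by (auto simp: simple_graph_def complete_graph_def)

lemma simple_graph_contract: "simple_graph (contract G F)"
  by (auto simp: simple_graph_def contract_def Let_def card_2_iff)

lemma simple_graph_kneser:
  assumes "0 < k"
  shows "simple_graph (kneser_graph n k)"
  using assms by (fastforce simp: simple_graph_def kneser_graph_def Let_def card_2_iff)

lemma simple_graph_schrijver:
  assumes "0 < k"
  shows "simple_graph (schrijver_graph n k)"
  using simple_graph_kneser[OF assms]
  by (auto simp: simple_graph_def schrijver_graph_def induced_subgraph_def)

end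

theory Submission
  imports Defs
begin

text \<open>The graphs \<open>S(2k,k) \<subseteq> S(2k+1,k) \<subseteq> \<dots> \<subseteq> S(n,k)\<close> form a chain. The first has just the two adjacent
  vertices \<open>odds k\<close> and \<open>evens k\<close>. The vertices new in \<open>S(l,k)\<close> are the red ones, which contain \<open>l\<close>,
  and the blue ones, which contain both \<open>1\<close> and \<open>l - 1\<close>; together they induce a connected bipartite
  graph, because a red set can be moved down to \<open>{2, 4, \<dots>, 2k - 2, l}\<close> one step of one element at a
  time, through common blue neighbours. Every vertex of \<open>S(l-1,k)\<close> has a red neighbour in \<open>S(l,k)\<close>
  (shift all elements by one, and the largest to \<open>l\<close>). Hence, counting \<open>odds k\<close> and \<open>evens k\<close> as red,
  each level contributes one bipartite branch set, and any two branch sets are joined by a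
  red-red edge.\<close>

section \<open>Complete odd-minors from a vertex labelling and a two-colouring\<close>

lemma has_odd_minor_mono:
  assumes "has_odd_minor G H" and "verts G \<subseteq> verts G2" and "edges G \<subseteq> edges G2"
  shows "has_odd_minor G2 H"
  using assms unfolding has_odd_minor_def subgraph_def by (meson order_trans)

text \<open>\<open>f\<close> names the branch set of a vertex and \<open>S\<close> is one of two
  colour classes. Bichromatic edges connect each class of \<open>f\<close>, so contracting them
  collapses it to a point; a monochromatic edge between two classes is outside the cut and
  survives.\<close>

lemma has_odd_minor_completeI:
  fixes G :: "'a graph" and f :: "'a \<Rightarrow> nat"
  assumes simple: "simple_graph G"
    and surj: "f ` verts G = {1..m}"
    and conn: "\<And>u v. u \<in> verts G \<Longrightarrow> v \<in> verts G \<Longrightarrow> f u = f v \<Longrightarrow>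
      (u, v) \<in> {(x, y). {x, y} \<in> edges G \<and> f x = f y \<and> (x \<in> S \<longleftrightarrow> y \<notin> S)}\<^sup>*"
    and adj: "\<And>i j. i < j \<Longrightarrow> i \<in> {1..m} \<Longrightarrow> j \<in> {1..m} \<Longrightarrow>
      \<exists>u v. f u = i \<and> f v = j \<and> {u, v} \<in> edges G \<and> (u \<in> S \<longleftrightarrow> v \<in> S)"
  shows "has_odd_minor G (complete_graph m)"
proof -
  \<comment> \<open>Deleting the bichromatic edges between different classes makes the cut consist of exactly the
    bichromatic edges inside the classes.\<close>
  define V where "V = verts G"
  define D where "D = {{x, y} | x y. {x, y} \<in> edges G \<and> f x \<noteq> f y \<and> (x \<in> S \<longleftrightarrow> y \<notin> S)}"
  define G' where "G' = (V, edges G - D)"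
  define cut where "cut = edge_cut G' (S \<inter> V)"
  have edV: "x \<in> V \<and> y \<in> V \<and> x \<noteq> y" if "{x, y} \<in> edges G" for x y
    using simple that unfolding simple_graph_def V_def by (metis card_2_iff doubleton_eq_iff insert_subset)
  have D_iff: "{x, y} \<in> D \<longleftrightarrow> {x, y} \<in> edges G \<and> f x \<noteq> f y \<and> (x \<in> S \<longleftrightarrow> y \<notin> S)" for x y
    unfolding D_def by (auto simp: doubleton_eq_iff insert_commute)
  have cut_iff: "{x, y} \<in> cut \<longleftrightarrow> {x, y} \<in> edges G \<and> f x = f y \<and> (x \<in> S \<longleftrightarrow> y \<notin> S)" for x y
  proof
    assume "{x, y} \<in> cut"
    then obtain u v where "{x, y} = {u, v}" "u \<in> S" "v \<in> V - S \<inter> V" "{u, v} \<in> edges G - D"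
      unfolding cut_def edge_cut_def G'_def by auto
    then show "{x, y} \<in> edges G \<and> f x = f y \<and> (x \<in> S \<longleftrightarrow> y \<notin> S)"
      using D_iff[of x y] by (auto simp: doubleton_eq_iff insert_commute)
  next
    assume *: "{x, y} \<in> edges G \<and> f x = f y \<and> (x \<in> S \<longleftrightarrow> y \<notin> S)"
    then have "{x, y} \<in> edges G - D" "x \<in> V" "y \<in> V" using D_iff edV by auto
    then have "(x \<in> S \<and> y \<in> V - S \<inter> V \<and> {x, y} \<in> edges G - D) \<or>
        (y \<in> S \<and> x \<in> V - S \<inter> V \<and> {y, x} \<in> edges G - D)"
      using * by (auto simp: insert_commute)
    then show "{x, y} \<in> cut"
      unfolding cut_def edge_cut_def G'_def using \<open>x \<in> V\<close> \<open>y \<in> V\<close>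
      by (fastforce simp: insert_commute)
  qed
  define R where "R = {(x, y). {x, y} \<in> cut}"
  have R_eq: "R = {(x, y). {x, y} \<in> edges G \<and> f x = f y \<and> (x \<in> S \<longleftrightarrow> y \<notin> S)}"
    unfolding R_def using cut_iff by auto
  have f_R: "f x = f y" if "(x, y) \<in> R\<^sup>*" for x y
    using that by induction (auto simp: R_eq)
  \<comment> \<open>The components of the cut are exactly the classes of \<open>f\<close>: cut edges
    preserve \<open>f\<close>, and \<open>conn\<close> gives the converse.\<close>
  have cb: "connected_by G' cut = {(u, v). u \<in> V \<and> v \<in> V \<and> f u = f v}"
    unfolding connected_by_def G'_def using conn f_R unfolding R_def[symmetric] R_eq[symmetric]
    by (auto simp: V_def)
  define cl where "cl i = {v \<in> V. f v = i}" for i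
  have C: "V // connected_by G' cut = cl ` {1..m}"
  proof -
    have "connected_by G' cut `` {v} = cl (f v)" if "v \<in> V" for v
      using that by (auto simp: cb cl_def)
    then have "V // connected_by G' cut = (\<lambda>v. cl (f v)) ` V"
      by (simp add: quotient_def UNION_singleton_eq_range)
    then show ?thesis unfolding surj[folded V_def, symmetric] image_image .
  qed
  have cl_ne: "\<exists>v. v \<in> cl i" if "i \<in> {1..m}" for i
  proof -
    have "i \<in> f ` V" using that surj[folded V_def] by simp
    then show ?thesis by (auto simp: cl_def)
  qed
  have inj: "inj_on cl {1..m}"
    by (rule inj_onI) (use cl_ne in \<open>auto simp: cl_def\<close>)
  have edge: "{cl i, cl j} \<in> edges (contract G' cut) \<longleftrightarrow> i \<noteq> j"
    if ij: "i \<in> {1..m}" "j \<in> {1..m}" for i j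
  proof
    assume "{cl i, cl j} \<in> edges (contract G' cut)"
    then show "i \<noteq> j" by (auto simp: contract_def Let_def doubleton_eq_iff)
  next
    assume "i \<noteq> j"
    then have "\<exists>u v. f u = i \<and> f v = j \<and> {u, v} \<in> edges G \<and> (u \<in> S \<longleftrightarrow> v \<in> S)"
      using adj[of i j] adj[of j i] ij by (metis insert_commute linorder_neqE_nat)
    then obtain u v where uv: "f u = i" "f v = j" "{u, v} \<in> edges G" "u \<in> S \<longleftrightarrow> v \<in> S"
      by blast
    \<comment> \<open>A monochromatic edge is neither deleted as a member of \<open>D\<close> nor
      contracted.\<close>
    then have "u \<in> cl i" "v \<in> cl j" "{u, v} \<in> edges G' - cut"
      using edV D_iff cut_iff by (auto simp: cl_def G'_def)
    moreover have "cl i \<noteq> cl j" using inj ij \<open>i \<noteq> j\<close> by (auto dest: inj_onD)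
    moreover have "cl i \<in> verts G' // connected_by G' cut" "cl j \<in> verts G' // connected_by G' cut"
      using C ij by (auto simp: G'_def)
    ultimately show "{cl i, cl j} \<in> edges (contract G' cut)"
      unfolding contract_def Let_def by auto
  qed
  have ceq: "{i, j} \<in> edges (complete_graph m) \<longleftrightarrow> i \<noteq> j" if "i \<in> {1..m}" "j \<in> {1..m}" for i j
    using that by (auto simp: complete_graph_def card_insert_if)
  have vC: "verts (contract G' cut) = cl ` {1..m}"
    using C by (auto simp: contract_def Let_def G'_def)
  define g where "g = inv_into {1..m} cl"
  have g_cl: "g (cl i) = i" if "i \<in> {1..m}" for i
    unfolding g_def using inj that by (rule inv_into_f_f)
  have "bij_betw g (cl ` {1..m}) {1..m}"
    unfolding g_def using inj by (simp add: bij_betw_inv_into inj_on_imp_bij_betw)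
  moreover have "{u, v} \<in> edges (contract G' cut) \<longleftrightarrow> {g u, g v} \<in> edges (complete_graph m)"
    if "u \<in> cl ` {1..m}" "v \<in> cl ` {1..m}" for u v
    using that edge ceq g_cl by (metis (no_types, lifting) imageE)
  ultimately have "graph_iso (contract G' cut) (complete_graph m)"
    unfolding graph_iso_def vC by (intro exI[of _ g]) (simp add: complete_graph_def)
  moreover have "subgraph G' G"
    using simple unfolding subgraph_def simple_graph_def G'_def V_def by auto
  ultimately show ?thesis
    unfolding has_odd_minor_def cut_def by (intro exI[of _ G'] exI[of _ "S \<inter> V"]) (auto simp: G'_def)
qed

section \<open>Stable sets of natural numbers\<close>

text \<open>Stability in the linear order only, so that it is independent of \<open>n\<close> and
  invariant under shifts; the wrap-around pair \<open>1\<close>, \<open>n\<close> is treated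
  separately.\<close>

definition stable :: "nat set \<Rightarrow> bool" where
  "stable A \<longleftrightarrow> (\<forall>a\<in>A. Suc a \<notin> A)"

definition evens :: "nat \<Rightarrow> nat set" where
  "evens k = (*) 2 ` {1..k}"

definition odds :: "nat \<Rightarrow> nat set" where
  "odds k = (\<lambda>i. 2 * i - 1) ` {1..k}"

text \<open>Away from \<open>n\<close> the cyclic successor is \<open>Suc\<close>, and at
  \<open>n\<close> it adds the pair \<open>n\<close>, \<open>1\<close>. The bound excludes
  \<open>n = 1\<close>, where \<open>{1}\<close> is cyclically stable but would fail the last
  conjunct.\<close>

lemma cyclically_stable_iff:
  assumes "2 \<le> n"
  shows "cyclically_stable n A \<longleftrightarrow> A \<subseteq> {1..n} \<and> stable A \<and> \<not> (1 \<in> A \<and> n \<in> A)"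
proof (cases "A \<subseteq> {1..n}")
  case True
  then have "Suc n \<notin> A" by auto
  with True assms show ?thesis
    unfolding cyclically_stable_def cyclic_succ_def stable_def by (auto split: if_splits)
qed (simp add: cyclically_stable_def)

lemma verts_schrijver:
  assumes "2 \<le> n"
  shows "verts (schrijver_graph n k) =
    {A. A \<subseteq> {1..n} \<and> card A = k \<and> stable A \<and> \<not> (1 \<in> A \<and> n \<in> A)}"
  using assms
  by (auto simp: schrijver_graph_def induced_subgraph_def kneser_graph_def Let_def cyclically_stable_iff)

lemma edge_schrijver_iff:
  "{A, B} \<in> edges (schrijver_graph n k) \<longleftrightarrow>
    A \<in> verts (schrijver_graph n k) \<and> B \<in> verts (schrijver_graph n k) \<and> A \<inter> B = {}"
  by (auto simp: schrijver_graph_def induced_subgraph_def kneser_graph_def Let_def doubleton_eq_iff)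

lemma stable_Suc_image: "stable (Suc ` A) \<longleftrightarrow> stable A"
  by (auto simp: stable_def)

text \<open>Distinct numbers with the same half are \<open>2 * q\<close> and
  \<open>2 * q + 1\<close>, and a stable set cannot contain both.\<close>

lemma inj_on_div2:
  assumes "stable A"
  shows "inj_on (\<lambda>a. a div 2) A"
proof (rule inj_onI)
  fix a b :: nat
  assume "a \<in> A" "b \<in> A" "a div 2 = b div 2"
  moreover have "a = b \<or> b = Suc a \<or> a = Suc b"
    using \<open>a div 2 = b div 2\<close> by presburger
  ultimately show "a = b" using assms by (auto simp: stable_def)
qed


text \<open>Halving embeds \<open>A\<close> into \<open>{1..n div 2}\<close>; the lower bound
  \<open>2\<close> keeps the value \<open>0\<close> out.\<close>

lemma card_stable_le:
  assumes "A \<subseteq> {2..n}" "stable A"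
  shows "2 * card A \<le> n"
proof -
  have "(\<lambda>a. a div 2) ` A \<subseteq> {1..n div 2}"
    using assms(1) by (force simp: div_le_mono)
  then have "card A \<le> n div 2"
    using card_image[OF inj_on_div2[OF assms(2)]] card_mono[of "{1..n div 2}"]
    by (metis card_atLeastAtMost diff_Suc_1 finite_atLeastAtMost)
  then show ?thesis by simp
qed

lemma card_evens: "card (evens k) = k"
  by (simp add: evens_def card_image inj_on_def)

lemma stable_eq_evens:
  assumes "A \<subseteq> {2..2 * k}" "stable A" "card A = k"
  shows "A = evens k"
proof -
  \<comment> \<open>\<open>A\<close> has one element in each of the pairs \<open>{2, 3}, {4, 5}, \<dots>\<close>, the last pair being cut to \<open>{2k}\<close>;
    stability then propagates the choice of the even element downwards.\<close>
  have "(\<lambda>a. a div 2) ` A \<subseteq> {1..k}"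
    using assms(1) by force
  then have im: "(\<lambda>a. a div 2) ` A = {1..k}"
    using card_image[OF inj_on_div2[OF assms(2)]] assms(3) by (intro card_subset_eq) auto
  have "2 * i \<in> A" if "1 \<le> i" "i \<le> k" for i
    using that(2,1)
  proof (induction i rule: inc_induct)
    case base
    then have "k \<in> (\<lambda>a. a div 2) ` A" using im by auto
    then obtain a where a: "a \<in> A" "k = a div 2" by auto
    moreover have "a \<le> 2 * k" using a assms(1) by auto
    ultimately have "a = 2 * k" by presburger
    with a(1) show ?case by simp
  next
    case (step i)
    then have "i \<in> (\<lambda>a. a div 2) ` A" using im by auto
    then obtain a where a: "a \<in> A" "i = a div 2" by auto
    have "a \<noteq> Suc (2 * i)"
      using step a assms(2) by (auto simp: stable_def)
    then have "a = 2 * i" using a(2) by presburger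
    with a(1) show ?case by simp
  qed
  then have "evens k \<subseteq> A" by (auto simp: evens_def)
  then show ?thesis
    using assms card_evens[of k] finite_subset[OF assms(1)] by (metis card_subset_eq finite_atLeastAtMost)
qed

text \<open>Subtracting 2 repeatedly from an odd element would end in the excluded \<open>1\<close>,
  so all elements are even, and their halves form an initial segment of the positive integers. This
  identifies the red set that admits no further descent.\<close>

lemma evens_closed_down:
  assumes "finite D" "0 \<notin> D" "1 \<notin> D" "\<And>r. r \<in> D \<Longrightarrow> 3 \<le> r \<Longrightarrow> r - 2 \<in> D"
  shows "D = evens (card D)"
proof -
  define E where "E = {e. 2 * e \<in> D}"
  have ev: "even r" if "r \<in> D" for r
    using that
  proof (induction r rule: less_induct)
    case (less r)
    show ?case
    proof (cases "3 \<le> r")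
      case True
      then have "even (r - 2)" using less.IH[of "r - 2"] less.prems assms(4) by auto
      with True show ?thesis by simp
    next
      case False
      moreover have "r \<noteq> 0" "r \<noteq> 1" using less.prems assms by metis+
      ultimately have "r = 2" by linarith
      then show ?thesis by simp
    qed
  qed
  have D: "D = (*) 2 ` E"
    using ev by (auto simp: E_def elim!: evenE)
  have fin: "finite E" unfolding D using assms(1) D by (metis finite_imageD inj_on_def mult_left_cancel zero_neq_numeral)
  have "0 \<notin> E" using assms(2) by (simp add: E_def)
  have down: "i \<in> E" if "j \<in> E" "1 \<le> i" "i \<le> j" for i j
    using that(3,2)
  proof (induction i rule: inc_induct)
    case base
    show ?case by fact
  next
    case (step i)
    then have "2 * Suc i \<in> D" by (simp add: E_def)
    then have "2 * Suc i - 2 \<in> D" using step by (intro assms(4)) auto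
    then show ?case by (simp add: E_def)
  qed
  have "E = {1..card E}"
  proof (cases "E = {}")
    case False
    have "E = {1..Max E}"
    proof
      show "E \<subseteq> {1..Max E}"
        using fin \<open>0 \<notin> E\<close> by (auto simp: Suc_le_eq intro: gr0I)
      show "{1..Max E} \<subseteq> E"
        using down Max_in[OF fin False] by auto
    qed
    then show ?thesis by (metis card_atLeastAtMost diff_Suc_1 One_nat_def)
  qed simp
  moreover have "card D = card E" unfolding D by (simp add: card_image inj_on_def)
  ultimately show ?thesis using D by (simp add: evens_def)
qed

section \<open>Moving stable sets up to a given level\<close>

definition push :: "nat set \<Rightarrow> nat \<Rightarrow> nat set" where
  "push A l = insert l (Suc ` (A - {Max A}))"

text \<open>A non-maximal element \<open>a\<close> of a stable set satisfies
  \<open>a + 2 \<le> Max A < l\<close>, so its shift is at most \<open>l - 2\<close> and leaves a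
  gap below \<open>l\<close>. Disjointness from \<open>A\<close> is stability again, together with
  \<open>l \<notin> A\<close>.\<close>

lemma push:
  assumes "A \<noteq> {}" "A \<subseteq> {1..<l}" "stable A"
  shows "push A l \<subseteq> {2..l}" "l \<in> push A l" "stable (push A l)" "card (push A l) = card A"
    "push A l \<inter> A = {}"
proof -
  have fin: "finite A" using assms(2) by (rule finite_subset) simp
  have MA: "Max A \<in> A" using fin assms(1) by simp
  have small: "Suc (Suc a) \<le> Max A" if "a \<in> A - {Max A}" for a
  proof -
    have "a \<le> Max A" using that fin by auto
    moreover have "a \<noteq> Max A" "Suc a \<noteq> Max A" using that MA assms(3) by (auto simp: stable_def)
    ultimately show ?thesis by linarith
  qed
  have Ml: "1 \<le> Max A" "Max A < l" using MA assms(2) by auto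
  have l: "Suc (Suc a) < l" if "a \<in> A - {Max A}" for a
    using small[OF that] Ml by linarith
  show "push A l \<subseteq> {2..l}"
    using l Ml assms(2) unfolding push_def by force
  show "l \<in> push A l" by (simp add: push_def)
  show "stable (push A l)"
    using l assms(3) unfolding push_def stable_def by force
  have "l \<notin> Suc ` (A - {Max A})" using l by force
  then show "card (push A l) = card A"
    using fin MA card_gt_0_iff[of A] assms(1) unfolding push_def by (simp add: card_image)
  show "push A l \<inter> A = {}"
    using assms(2,3) unfolding push_def stable_def by auto
qed

section \<open>Connectivity of the red and blue sets of one level\<close>

text \<open>The lower bound \<open>2\<close> encodes the wrap-around condition: \<open>l\<close> is
  present, so \<open>1\<close> must be absent.\<close>

definition red :: "nat \<Rightarrow> nat \<Rightarrow> nat set set" where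
  "red k l = {A. A \<subseteq> {2..l} \<and> l \<in> A \<and> stable A \<and> card A = k}"

text \<open>The strict bound keeps \<open>l\<close> out, as \<open>1\<close> is present. For
  \<open>l > 2\<close> the elements \<open>1\<close> and \<open>l - 1\<close> are neighbours in the
  cyclic order of length \<open>l - 1\<close>, so the set is not yet a vertex one level
  below.\<close>

definition blue :: "nat \<Rightarrow> nat \<Rightarrow> nat set set" where
  "blue k l = {A. A \<subseteq> {1..<l} \<and> 1 \<in> A \<and> l - 1 \<in> A \<and> stable A \<and> card A = k}"

lemma red_push:
  assumes "A \<noteq> {}" "A \<subseteq> {1..<l}" "stable A" "card A = k"
  shows "push A l \<in> red k l" "A \<inter> push A l = {}"
  using push[OF assms(1-3)] assms(4) by (auto simp: red_def)

text \<open>Stepping from \<open>r\<close> to \<open>r - 1\<close> keeps stability because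
  \<open>r - 2\<close> is free. The blue neighbour consists of \<open>1\<close> and the shift of
  \<open>R - {l}\<close> with its top element sent to \<open>l - 1\<close>; successors of elements
  of \<open>R\<close> avoid \<open>R\<close> by stability.\<close>

lemma red_descent:
  assumes R: "R \<in> red k l" and r: "r \<in> R" "3 \<le> r" "r < l" "r - 2 \<notin> R"
  shows "insert (r - 1) (R - {r}) \<in> red k l"
    "\<exists>B\<in>blue k l. R \<inter> B = {} \<and> insert (r - 1) (R - {r}) \<inter> B = {}"
proof -
  have R': "R \<subseteq> {2..l}" "l \<in> R" "card R = k" and st: "\<And>a. a \<in> R \<Longrightarrow> Suc a \<notin> R"
    using R by (auto simp: red_def stable_def)
  have fin: "finite R" using R'(1) by (rule finite_subset) simp
  have r1: "r - 1 \<notin> R" using st[of "r - 1"] r by auto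
  have l1: "l - 1 \<notin> R" using st[of "l - 1"] r R' by auto
  have st1: "Suc a \<noteq> r - 1" if "a \<in> R" for a
  proof
    assume "Suc a = r - 1"
    then have "a = r - 2" by simp
    with that r(4) show False by simp
  qed
  have "stable (insert (r - 1) (R - {r}))"
    using st st1 r(2) unfolding stable_def by force
  then show "insert (r - 1) (R - {r}) \<in> red k l"
    using R' r r1 fin card_Suc_Diff1[OF fin r(1)] by (auto simp: red_def)
  \<comment> \<open>The common blue neighbour avoids \<open>r - 1\<close> since \<open>r - 2 \<notin> R\<close>.\<close>
  define P where "P = push (R - {l}) (l - 1)"
  have ne: "R - {l} \<noteq> {}" using r by auto
  have sub: "R - {l} \<subseteq> {1..<l - 1}"
  proof
    fix a assume a: "a \<in> R - {l}"
    then have "2 \<le> a" "a \<le> l" "a \<noteq> l" "a \<noteq> l - 1" using R' l1 by auto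
    then show "a \<in> {1..<l - 1}" by auto
  qed
  have "stable (R - {l})" using st by (auto simp: stable_def)
  note P = push[OF ne sub this, folded P_def]
  have P2: "a = l - 1 \<or> (\<exists>b\<in>R. a = Suc b)" if "a \<in> P" for a
    using that by (auto simp: P_def push_def)
  have fP: "finite P" using P(1) by (rule finite_subset) simp
  \<comment> \<open>Adding \<open>1\<close> to \<open>P\<close> requires
    \<open>2 \<notin> P\<close>: every element of \<open>P\<close> is \<open>l - 1\<close>, which is
    at least \<open>3\<close>, or the successor of an element of \<open>R\<close>, which omits
    \<open>1\<close>.\<close>
  have "1 \<notin> R" using R'(1) by auto
  then have "2 \<notin> P" using P2[of 2] r by (auto simp: numeral_2_eq_2)
  then have "stable (insert 1 P)"
    using P(1,3) r by (auto simp: stable_def numeral_2_eq_2)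
  moreover have "1 \<notin> P" using P(1) by auto
  then have "card (insert 1 P) = k"
    using P(4) R'(3) fP card_Suc_Diff1[OF fin R'(2)] by simp
  moreover have "a \<in> {1..<l}" if "a \<in> P" for a
    using subsetD[OF P(1) that] r by simp linarith
  ultimately have "insert 1 P \<in> blue k l"
    using P(2) r by (auto simp: blue_def)
  moreover have "R \<inter> insert 1 P = {}"
    using P2 R'(1) st l1 by fastforce
  moreover have "r - 1 \<noteq> l - 1" "r - 1 \<noteq> 1" using r(2,3) by linarith+
  then have "r - 1 \<notin> insert 1 P"
    using P2[of "r - 1"] st1 by (metis insertE)
  ultimately show "\<exists>B\<in>blue k l. R \<inter> B = {} \<and> insert (r - 1) (R - {r}) \<inter> B = {}"
    by (intro bexI[of _ "insert 1 P"]) auto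
qed

text \<open>If no element below \<open>l\<close> can descend, removing \<open>l\<close> leaves a set
  in which every \<open>r \<ge> 3\<close> comes with \<open>r - 2\<close>, hence an initial run of
  even numbers.\<close>

lemma red_minimal:
  assumes R: "R \<in> red k l" and "\<And>r. r \<in> R \<Longrightarrow> 3 \<le> r \<Longrightarrow> r < l \<Longrightarrow> r - 2 \<in> R"
  shows "R = insert l (evens (k - 1))"
proof -
  have R': "R \<subseteq> {2..l}" "l \<in> R" "card R = k"
    using R by (auto simp: red_def)
  have fin: "finite R" using R'(1) by (rule finite_subset) simp
  have "R - {l} = evens (card (R - {l}))"
  proof (rule evens_closed_down)
    fix r assume "r \<in> R - {l}" "3 \<le> r"
    then show "r - 2 \<in> R - {l}" using assms(2)[of r] R'(1) by force
  qed (use fin R'(1) in auto)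
  then show ?thesis using R' fin by (metis card_Diff_singleton insert_Diff)
qed

text \<open>Each descent lowers the sum of the elements and is realised by a path of two edges
  through the common blue neighbour. Induction on the sum ends in the unique red set without a
  descent.\<close>

lemma red_connected:
  assumes E: "\<And>A B. A \<in> red k l \<Longrightarrow> B \<in> blue k l \<Longrightarrow> A \<inter> B = {} \<Longrightarrow> (A, B) \<in> E \<and> (B, A) \<in> E"
    and "R \<in> red k l"
  shows "(R, insert l (evens (k - 1))) \<in> E\<^sup>*"
  using assms(2)
proof (induction "\<Sum>R" arbitrary: R rule: less_induct)
  case less
  show ?case
  proof (cases "\<forall>r\<in>R. 3 \<le> r \<and> r < l \<longrightarrow> r - 2 \<in> R")
    case True
    then show ?thesis using red_minimal[OF less.prems] by auto
  next
    case False
    then obtain r where r: "r \<in> R" "3 \<le> r" "r < l" "r - 2 \<notin> R" by blast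
    let ?R = "insert (r - 1) (R - {r})"
    have "finite R" using less.prems by (auto simp: red_def intro: finite_subset)
    then have "\<Sum>?R \<le> (r - 1) + \<Sum>(R - {r})"
      by (simp add: sum.insert_if)
    also have "\<dots> < \<Sum>R"
      using r \<open>finite R\<close> by (simp add: sum.remove[of R r])
    finally have "(?R, insert l (evens (k - 1))) \<in> E\<^sup>*"
      using red_descent(1)[OF less.prems r] less.hyps by blast
    moreover have "(R, ?R) \<in> E\<^sup>*"
      using red_descent[OF less.prems r] E less.prems
      by (meson converse_rtrancl_into_rtrancl r_into_rtrancl)
    ultimately show ?thesis by simp
  qed
qed

text \<open>A blue set is disjoint from its \<open>push\<close>, which is red, so every set of the
  level reaches the same red set; symmetry reverses the second path.\<close>

lemma red_blue_connected:
  assumes E: "\<And>A B. A \<in> red k l \<Longrightarrow> B \<in> blue k l \<Longrightarrow> A \<inter> B = {} \<Longrightarrow> (A, B) \<in> E \<and> (B, A) \<in> E"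
    and "sym E" and "A \<in> red k l \<union> blue k l" "B \<in> red k l \<union> blue k l"
  shows "(A, B) \<in> E\<^sup>*"
proof -
  have c: "(A, insert l (evens (k - 1))) \<in> E\<^sup>*" if "A \<in> red k l \<union> blue k l" for A
  proof (cases "A \<in> red k l")
    case True
    then show ?thesis using red_connected[OF E] by blast
  next
    case False
    then have A: "A \<in> blue k l" using that by blast
    then have "A \<noteq> {}" "A \<subseteq> {1..<l}" "stable A" "card A = k"
      by (auto simp: blue_def)
    then have "push A l \<in> red k l" "A \<inter> push A l = {}"
      by (simp_all add: red_push)
    then show ?thesis
      using red_connected[OF E] E[of "push A l" A] A
      by (metis Int_commute converse_rtrancl_into_rtrancl)
  qed
  then show ?thesis
    using assms(2-4) by (meson rtrancl_trans sym_rtrancl symD)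
qed

section \<open>Sorting the vertices of the Schrijver graph into levels\<close>

lemma evens: "evens k \<subseteq> {2..2 * k}" "stable (evens k)"
proof -
  show "evens k \<subseteq> {2..2 * k}" by (auto simp: evens_def)
  have "even a" if "a \<in> evens k" for a using that by (auto simp: evens_def)
  then show "stable (evens k)" unfolding stable_def by (metis even_Suc)
qed

lemma odds: "odds k \<subseteq> {1..<2 * k}" "stable (odds k)" "card (odds k) = k" "Suc ` odds k = evens k"
proof -
  show *: "Suc ` odds k = evens k"
    unfolding odds_def evens_def image_image by (rule image_cong) auto
  show "stable (odds k)" using * evens(2) stable_Suc_image by metis
  show "card (odds k) = k" using * card_evens by (metis card_image inj_Suc)
  show "odds k \<subseteq> {1..<2 * k}" unfolding odds_def by auto
qed

text \<open>The level \<open>l\<close> is \<open>Max A\<close> if \<open>1 \<notin> A\<close> and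
  \<open>Max A + 1\<close> otherwise. Then \<open>A\<close>, or its shift in the second case, is a
  stable subset of \<open>{2..l}\<close>; counting gives \<open>2 * k \<le> l\<close>, and equality
  forces \<open>evens k\<close> or \<open>odds k\<close>.\<close>

lemma schrijver_vertex_cases:
  assumes "0 < k" "2 * k \<le> n" and A: "A \<in> verts (schrijver_graph n k)"
  shows "A = odds k \<or> A = evens k \<or> (\<exists>l. 2 * k < l \<and> l \<le> n \<and> A \<in> red k l \<union> blue k l)"
proof -
  have A: "A \<subseteq> {1..n}" "card A = k" "stable A" "\<not> (1 \<in> A \<and> n \<in> A)"
    using A assms(1,2) by (auto simp: verts_schrijver)
  have "finite A" "A \<noteq> {}" using A(2) assms(1) by (auto intro: card_ge_0_finite)
  then have M: "Max A \<in> A" "\<And>a. a \<in> A \<Longrightarrow> a \<le> Max A" by auto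
  show ?thesis
  proof (cases "1 \<in> A")
    case False
    have sub: "A \<subseteq> {2..Max A}"
    proof
      fix a assume "a \<in> A"
      moreover from this have "a \<noteq> 1" "1 \<le> a" using False A(1) by auto
      ultimately show "a \<in> {2..Max A}" using M(2) by auto
    qed
    then have "2 * k \<le> Max A" using card_stable_le[OF sub A(3)] A(2) by simp
    moreover have "A \<in> red k (Max A)" "Max A \<le> n"
      using sub A M by (auto simp: red_def)
    moreover have "A = evens k" if "Max A = 2 * k"
      using stable_eq_evens[of A k] sub A that by auto
    ultimately show ?thesis by (metis UnI1 order_le_less)
  next
    case True
    define l where "l = Suc (Max A)"
    have sub: "Suc ` A \<subseteq> {2..l}"
      using A(1) M(2) by (force simp: l_def)
    have st: "stable (Suc ` A)" using A(3) by (simp add: stable_Suc_image)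
    have card: "card (Suc ` A) = k" using A(2) by (simp add: card_image)
    have "2 * k \<le> l" using card_stable_le[OF sub st] card by simp
    moreover have "A \<subseteq> {1..<l}" using A(1) M(2) by (force simp: l_def)
    then have "A \<in> blue k l" using True A M by (auto simp: blue_def l_def)
    \<comment> \<open>The wrap-around condition enters here: \<open>1 \<in> A\<close> excludes
      \<open>n\<close>.\<close>
    moreover have "Max A \<noteq> n" "Max A \<le> n" using M A True by auto
    then have "l \<le> n" by (simp add: l_def)
    moreover have "A = odds k" if "l = 2 * k"
      using stable_eq_evens[of "Suc ` A" k] sub st card that odds(4)[of k]
      by (metis inj_Suc inj_image_eq_iff)
    ultimately show ?thesis by (metis UnI2 order_le_less)
  qed
qed

section \<open>Branch sets by level and the edges between them\<close>

theorem theorem3: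
  fixes n k :: nat
  assumes "0 < n" and "0 < k" and "2 * k \<le> n"
  shows "has_odd_minor (schrijver_graph n k) (complete_graph (n - 2 * k + 2)) \<and>
         has_odd_minor (kneser_graph n k) (complete_graph (n - 2 * k + 2))"
proof -
  define G where "G = schrijver_graph n k"
  define m where "m = n - 2 * k + 2"
  \<comment> \<open>The red colour class. \<open>odds k\<close> contains \<open>1\<close> but is
    added, since its branch set needs red-red edges to all the others.\<close>
  define S where "S = {A. 1 \<notin> A \<or> A = odds k}"
  \<comment> \<open>Level \<open>l\<close> gets label \<open>l + 2 - 2 * k\<close>, so the top level
    \<open>n\<close> gets \<open>m\<close>. Both \<open>odds k\<close> and \<open>evens k\<close>
    have level \<open>2 * k\<close> and would share label 2; giving \<open>odds k\<close> label 1
    separates them.\<close>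
  define f where "f A = (if A = odds k then 1 else if A = evens k then 2
    else (if 1 \<in> A then Suc (Max A) else Max A) + 2 - 2 * k)" for A
  have V: "verts G = {A. A \<subseteq> {1..n} \<and> card A = k \<and> stable A \<and> \<not> (1 \<in> A \<and> n \<in> A)}"
    using assms verts_schrijver[of n k] by (simp add: G_def)
  have ed: "{A, B} \<in> edges G \<longleftrightarrow> A \<in> verts G \<and> B \<in> verts G \<and> A \<inter> B = {}" for A B
    unfolding G_def by (rule edge_schrijver_iff)
  have one_odds: "1 \<in> odds k" using assms(2) unfolding odds_def by force
  have two_k: "2 * k \<in> evens k" using assms(2) unfolding evens_def by force
  have one_evens: "1 \<notin> evens k" using evens(1)[of k] by auto
  then have f_odds: "f (odds k) = 1" and f_evens: "f (evens k) = 2"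
    using one_odds by (auto simp: f_def)
  have V_odds: "odds k \<in> verts G"
    using odds(1-3)[of k] assms by (fastforce simp: V)
  have V_evens: "evens k \<in> verts G"
    using evens[of k] card_evens[of k] one_evens assms by (fastforce simp: V)
  have red: "A \<in> verts G \<and> A \<in> S \<and> f A = l + 2 - 2 * k"
    if A: "A \<in> red k l" and l: "2 * k < l" "l \<le> n" for A l
  proof -
    have A': "A \<subseteq> {2..l}" "l \<in> A" "stable A" "card A = k"
      using A by (auto simp: red_def)
    then have "1 \<notin> A" by auto
    have "Max A = l" using A'(1,2) by (intro Max_eqI) (auto intro: finite_subset)
    moreover have "A \<noteq> odds k" "A \<noteq> evens k"
      using A'(2) l(1) odds(1)[of k] evens(1)[of k] by auto
    ultimately have "f A = l + 2 - 2 * k"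
      using \<open>1 \<notin> A\<close> by (simp add: f_def)
    moreover have "A \<subseteq> {1..n}" using A'(1) l(2) by auto
    ultimately show ?thesis using A' \<open>1 \<notin> A\<close> by (simp add: V S_def)
  qed
  have blue: "A \<in> verts G \<and> A \<notin> S \<and> f A = l + 2 - 2 * k"
    if A: "A \<in> blue k l" and l: "2 * k < l" "l \<le> n" for A l
  proof -
    have A': "A \<subseteq> {1..<l}" "1 \<in> A" "l - 1 \<in> A" "stable A" "card A = k"
      using A by (auto simp: blue_def)
    have "a \<le> l - 1" if "a \<in> A" for a using A'(1) that by force
    moreover have "finite A" using A'(1) by (rule finite_subset) simp
    ultimately have "Max A = l - 1" using A'(3) by (intro Max_eqI)
    moreover have "A \<noteq> odds k" "A \<noteq> evens k"
      using A'(2,3) l(1) subsetD[OF odds(1), of "l - 1" k] one_evens by auto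
    ultimately have "f A = l + 2 - 2 * k"
      using A'(2) l(1) by (simp add: f_def)
    moreover have "A \<subseteq> {1..n}" "n \<notin> A" using A'(1) l(2) by auto
    ultimately show ?thesis using A' \<open>A \<noteq> odds k\<close> by (simp add: V S_def)
  qed
  have cases: "A = odds k \<and> f A = 1 \<or> A = evens k \<and> f A = 2 \<or>
      (\<exists>l. 2 * k < l \<and> l \<le> n \<and> A \<in> red k l \<union> blue k l \<and> f A = l + 2 - 2 * k)"
    if "A \<in> verts G" for A
    using schrijver_vertex_cases[OF assms(2,3) that[unfolded G_def]] red blue f_odds f_evens by blast
  have push_red: "push A l \<in> verts G \<and> push A l \<in> S \<and> f (push A l) = l + 2 - 2 * k \<and> A \<inter> push A l = {}"
    if "A \<subseteq> {1..<l}" "A \<in> verts G" "2 * k < l" "l \<le> n" for A l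
  proof -
    have "A \<noteq> {}" using that(2) assms(2) by (auto simp: V)
    then show ?thesis
      using red_push[of A l k] that red by (auto simp: V)
  qed
  \<comment> \<open>The bound \<open>i + 2 * k - 2\<close> inverts the labelling; it makes the red
    representative of class \<open>i\<close> available for a \<open>push\<close> to any higher
    level.\<close>
  have rep: "\<exists>A\<in>verts G. f A = i \<and> A \<in> S \<and> A \<subseteq> {1..i + 2 * k - 2}" if "i \<in> {1..m}" for i
  proof -
    have "1 \<le> i" using that by simp
    then consider "i = 1" | "i = 2" | "3 \<le> i" by linarith
    then show ?thesis
    proof cases
      case 1
      have "odds k \<subseteq> {1..i + 2 * k - 2}"
        using 1 by (intro order_trans[OF odds(1)]) auto
      then show ?thesis using 1 V_odds f_odds
        by (intro bexI[of _ "odds k"]) (auto simp: S_def)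
    next
      case 2
      have "evens k \<subseteq> {1..i + 2 * k - 2}"
        using 2 by (intro order_trans[OF evens(1)]) auto
      then show ?thesis using 2 V_evens f_evens one_evens
        by (intro bexI[of _ "evens k"]) (auto simp: S_def)
    next
      case 3
      define l where "l = i + 2 * k - 2"
      have l: "2 * k < l" "l \<le> n" "l + 2 - 2 * k = i"
        using 3 that assms(3) by (auto simp: l_def m_def)
      moreover have sub: "odds k \<subseteq> {1..<l}" using odds(1)[of k] l by auto
      ultimately have "push (odds k) l \<in> verts G \<and> push (odds k) l \<in> S \<and> f (push (odds k) l) = i"
        using push_red[OF sub V_odds] by simp
      moreover have "push (odds k) l \<subseteq> {1..l}"
        using push(1)[OF _ sub odds(2)] one_odds by force
      ultimately show ?thesis unfolding l_def by blast
    qed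
  qed
  have "has_odd_minor G (complete_graph m)"
  proof (rule has_odd_minor_completeI[where f = f and S = S])
    show "simple_graph G" using assms by (simp add: G_def simple_graph_schrijver)
    show "f ` verts G = {1..m}"
    proof
      show "f ` verts G \<subseteq> {1..m}"
        using cases unfolding m_def by fastforce
      show "{1..m} \<subseteq> f ` verts G" using rep by blast
    qed
  next
    fix A B assume AB: "A \<in> verts G" "B \<in> verts G" "f A = f B"
    define E where "E = {(x, y). {x, y} \<in> edges G \<and> f x = f y \<and> (x \<in> S \<longleftrightarrow> y \<notin> S)}"
    have "sym E" by (auto simp: E_def sym_def insert_commute)
    have *: "(A, B) \<in> E \<and> (B, A) \<in> E"
      if "A \<in> red k l" "B \<in> blue k l" "A \<inter> B = {}" "2 * k < l" "l \<le> n" for A B l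
      using that red blue by (auto simp: E_def ed)
    consider "A = odds k" "f A = 1" | "A = evens k" "f A = 2"
      | l where "2 * k < l" "l \<le> n" "A \<in> red k l \<union> blue k l" "f A = l + 2 - 2 * k"
      using cases[OF AB(1)] by blast
    then show "(A, B) \<in> E\<^sup>*"
    proof cases
      case 1
      then have "f B = 1" using AB(3) by simp
      then have "B = odds k" using cases[OF AB(2)] by auto
      with 1 show ?thesis by simp
    next
      case 2
      then have "f B = 2" using AB(3) by simp
      then have "B = evens k" using cases[OF AB(2)] by auto
      with 2 show ?thesis by simp
    next
      case (3 l)
      then have fB: "f B = l + 2 - 2 * k" using AB(3) by simp
      then have "f B \<noteq> 1" "f B \<noteq> 2" using 3(1) by linarith+
      then obtain l' where l': "2 * k < l'" "B \<in> red k l' \<union> blue k l'" "f B = l' + 2 - 2 * k"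
        using cases[OF AB(2)] by blast
      \<comment> \<open>Equal labels mean equal levels: both levels exceed \<open>2 * k\<close>, so
        the subtraction does not truncate.\<close>
      have "l = l'" using fB l'(1,3) 3(1) by linarith
      then show ?thesis
        using red_blue_connected[of k l E A B] * \<open>sym E\<close> 3(1-3) l'(2) by blast
    qed
  next
    fix i j assume ij: "i < j" "i \<in> {1..m}" "j \<in> {1..m}"
    show "\<exists>A B. f A = i \<and> f B = j \<and> {A, B} \<in> edges G \<and> (A \<in> S \<longleftrightarrow> B \<in> S)"
    proof (cases "j = 2")
      case True
      then have "i = 1" using ij by auto
      \<comment> \<open>\<open>evens k\<close> is the shift of the stable set
        \<open>odds k\<close>.\<close>
      have "odds k \<inter> evens k = {}"
        using odds(2,4)[of k] by (auto simp: stable_def simp flip: odds(4))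
      then show ?thesis
        using True \<open>i = 1\<close> V_odds V_evens f_odds f_evens one_evens ed by (auto simp: S_def)
    next
      case False
      define l where "l = j + 2 * k - 2"
      have l: "2 * k < l" "l \<le> n" "l + 2 - 2 * k = j"
        using False ij assms(3) by (auto simp: l_def m_def)
      obtain A where A: "A \<in> verts G" "f A = i" "A \<in> S" "A \<subseteq> {1..i + 2 * k - 2}"
        using rep[OF ij(2)] by blast
      \<comment> \<open>As \<open>i < j\<close> and \<open>k > 0\<close>, the representative lies
        strictly below level \<open>l\<close>, so its \<open>push\<close> is a red neighbour with
        label \<open>j\<close>.\<close>
      have "A \<subseteq> {1..<l}"
        using A(4) ij assms(2) unfolding l_def by fastforce
      then show ?thesis
        using push_red[of A l] A l ed by (intro exI[of _ A] exI[of _ "push A l"]) auto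
    qed
  qed
  moreover have "verts G \<subseteq> verts (kneser_graph n k)" "edges G \<subseteq> edges (kneser_graph n k)"
    by (auto simp: G_def schrijver_graph_def induced_subgraph_def)
  ultimately show ?thesis
    using has_odd_minor_mono unfolding G_def m_def by blast
qed

end
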